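(* Let $H,K$ be complex Banach spaces, let $A_0,A_1\in\mathcal L(H,K)$ with $A_0$ singular, and let $A(z)=A_0+A_1z$. Suppose the resolvent $R(z)=A(z)^{-1}\in\mathcal L(K,H)$ has isolated singularities at finitely many distinct points $z_1,\ldots,z_m\in\mathbb C$ ($m\ge1$) and is defined and analytic at all other points of $\mathbb C$. For each $k$ let $\{R_{k,-1},R_{k,0}\}$ be the basic solution at $z_k$ (defined in the context), and let $P_k=R_{k,-1}A_1\in\mathcal L(H)$ and $Q_k=A_1R_{k,-1}\in\mathcal L(K)$ be the corresponding projections. Then: (1) $P_kP_\ell=0$ and $Q_kQ_\ell=0$ for all $k\ne\ell$. Hence $P_\infty=\prod_{k=1}^m(I-P_k)=I-\sum_{k=1}^mP_k$ and $Q_\infty=\prod_{k=1}^m(I-Q_k)=I-\sum_{k=1}^mQ_k$ are projections on $H$ and $K$ respectively. (2) $H=M_1\oplus\cdots\oplus M_m\oplus M_\infty$ and $K=N_1\oplus\cdots\oplus N_m\oplus N_\infty$, where $M_k=P_k(H)$, $N_k=Q_k(K)$, $M_\infty=P_\infty(H)$, $N_\infty=Q_\infty(K)$. (3) For all $z\in\mathbb C\setminus\{z_1,\ldots,z_m\}$, $$R(z)=\sum_{k=1}^mR_{[k]}(z)+R_{[\infty]}(z),$$ where $R_{[k]}(z)=P_kR(z)Q_k$, regarded as an element of $\mathcal L(N_k,M_k)$, is (i.e. extends to be) analytic for all $z\ne z_k$, and $R_{[\infty]}(z)=P_\infty R(z)Q_\infty$, regarded as an element of $\mathcal L(N_\infty,M_\infty)$,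 is (i.e. extends to be) entire.
   Context: $\mathcal L(H,K)$ denotes the bounded linear operators from $H$ to $K$, and $\mathcal L(H)=\mathcal L(H,H)$. "$A_0$ is singular" means that $A_0$ has no inverse in $\mathcal L(K,H)$. Projections are bounded idempotent operators. Write $A(z)=A_{k,0}+A_1(z-z_k)$ with $A_{k,0}=A_0+A_1z_k$, and let $r_k=\min_{j\ne k}|z_j-z_k|$ (with $r_k=\infty$ and $1/r_k=0$ if $m=1$). The basic solution at $z_k$, i.e. on the punctured disc $0<|z-z_k|<r_k$, is the unique pair $R_{k,-1},R_{k,0}\in\mathcal L(K,H)$ such that (i) $R_{k,-1}A_1+R_{k,0}A_{k,0}=I$ and $A_1R_{k,-1}+A_{k,0}R_{k,0}=I$; (ii) $R_{k,-1}BR_{k,0}=0$ and $R_{k,0}BR_{k,-1}=0$ for $B\in\{A_{k,0},A_1\}$; (iii) $\lim_{j\to\infty}\|(R_{k,-1}A_{k,0})^j\|^{1/j}=0$ and $\lim_{j\to\infty}\|(R_{k,0}A_1)^j\|^{1/j}\le1/r_k$. Equivalently, $R_{k,-1}$ and $R_{k,0}$ are the coefficients of $(z-z_k)^{-1}$ and $(z-z_k)^0$ in the Laurent expansion of $R(z)$ about $z_k$. Such a pair exists and $P_k$, $Q_k$ are then projections. *)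

theory Defs
  imports "HOL-Analysis.Analysis"
begin

section \<open>Complex normed and Banach spaces\<close>

class scaleC =
  fixes scaleC :: "complex \<Rightarrow> 'a \<Rightarrow> 'a"  (infixr \<open>*\<^sub>C\<close> 75)

class complex_normed_vector = real_normed_vector + scaleC +
  assumes scaleC_add_right: "a *\<^sub>C (x + y) = a *\<^sub>C x + a *\<^sub>C y"
    and scaleC_add_left: "(a + b) *\<^sub>C x = a *\<^sub>C x + b *\<^sub>C x"
    and scaleC_scaleC: "a *\<^sub>C b *\<^sub>C x = (a * b) *\<^sub>C x"
    and scaleC_one: "1 *\<^sub>C x = x"
    and scaleC_of_real: "complex_of_real r *\<^sub>C x = r *\<^sub>R x"
    and norm_scaleC: "norm (a *\<^sub>C x) = cmod a * norm x"

class complex_banach = complex_normed_vector + banach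

instantiation complex :: complex_banach
begin

definition scaleC_complex :: "complex \<Rightarrow> complex \<Rightarrow> complex"
  where "scaleC_complex = (*)"

instance
  by standard
    (simp_all add: scaleC_complex_def algebra_simps norm_mult scaleR_conv_of_real)

end

lemma bounded_linear_scaleC:
  "bounded_linear (\<lambda>x :: 'a :: complex_normed_vector. c *\<^sub>C x)"
proof (rule bounded_linear_intro[where K = "cmod c"])
  fix r :: real and x y :: 'a
  show "c *\<^sub>C (x + y) = c *\<^sub>C x + c *\<^sub>C y"
    by (rule scaleC_add_right)
  show "c *\<^sub>C (r *\<^sub>R x) = r *\<^sub>R (c *\<^sub>C x)"
    by (simp add: scaleC_of_real[symmetric] scaleC_scaleC mult.commute)
  show "norm (c *\<^sub>C x) \<le> norm x * cmod c"
    by (simp add: norm_scaleC mult.commute)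
qed

text \<open>Pointwise complex scaling makes the real-linear bounded operators into a complex normed
  space; the complex-linear operators form a closed complex subspace of it, with the same norm.\<close>

instantiation blinfun :: (real_normed_vector, complex_normed_vector) complex_normed_vector
begin

lift_definition scaleC_blinfun :: "complex \<Rightarrow> ('a \<Rightarrow>\<^sub>L 'b) \<Rightarrow> 'a \<Rightarrow>\<^sub>L 'b"
  is "\<lambda>c f x. c *\<^sub>C f x"
  by (rule bounded_linear_compose[OF bounded_linear_scaleC])

instance
proof
  fix a b :: complex and r :: real and x y :: "'a \<Rightarrow>\<^sub>L 'b"
  show "a *\<^sub>C (x + y) = a *\<^sub>C x + a *\<^sub>C y"
    by transfer (simp add: scaleC_add_right)
  show "(a + b) *\<^sub>C x = a *\<^sub>C x + b *\<^sub>C x"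
    by transfer (simp add: scaleC_add_left)
  show "a *\<^sub>C b *\<^sub>C x = (a * b) *\<^sub>C x"
    by transfer (simp add: scaleC_scaleC)
  show "1 *\<^sub>C x = x"
    by transfer (simp add: scaleC_one)
  show "complex_of_real r *\<^sub>C x = r *\<^sub>R x"
    by transfer (simp add: scaleC_of_real)
  have le: "norm (c *\<^sub>C f) \<le> cmod c * norm f" for c :: complex and f :: "'a \<Rightarrow>\<^sub>L 'b"
  proof (rule norm_blinfun_bound)
    show "norm (blinfun_apply (c *\<^sub>C f) v) \<le> cmod c * norm f * norm v" for v
      using mult_left_mono[OF norm_blinfun[of f v], of "cmod c"]
      by (simp add: scaleC_blinfun.rep_eq norm_scaleC mult.assoc)
  qed simp
  show "norm (a *\<^sub>C x) = cmod a * norm x"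
  proof (cases "a = 0")
    case True
    then show ?thesis using le[of 0 x] by simp
  next
    case False
    have "inverse a *\<^sub>C a *\<^sub>C x = x"
      using False by transfer (simp add: scaleC_scaleC scaleC_one)
    then have "norm x \<le> inverse (cmod a) * norm (a *\<^sub>C x)"
      using le[of "inverse a" "a *\<^sub>C x"] by (simp add: norm_inverse)
    then have "cmod a * norm x \<le> norm (a *\<^sub>C x)"
      using False by (simp add: field_simps)
    then show ?thesis using le[of a x] by simp
  qed
qed

end

instance blinfun :: (real_normed_vector, complex_banach) complex_banach ..

definition csubspace :: "'a :: complex_normed_vector set \<Rightarrow> bool"
  where "csubspace S \<longleftrightarrow>
    0 \<in> S \<and> (\<forall>x\<in>S. \<forall>y\<in>S. x + y \<in> S) \<and> (\<forall>c. \<forall>x\<in>S. c *\<^sub>C x \<in> S)"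

text \<open>The whole space is the internal direct sum of the finitely many closed subspaces M i.\<close>

definition direct_sum :: "'i set \<Rightarrow> ('i \<Rightarrow> 'a :: complex_normed_vector set) \<Rightarrow> bool"
  where "direct_sum I M \<longleftrightarrow>
    finite I \<and> (\<forall>i\<in>I. csubspace (M i) \<and> closed (M i)) \<and>
    (\<forall>x. \<exists>!f. f \<in> (\<Pi>\<^sub>E i\<in>I. M i) \<and> x = (\<Sum>i\<in>I. f i))"


section \<open>Complex-linear bounded operators\<close>

definition cblinfuns :: "('a :: complex_normed_vector \<Rightarrow>\<^sub>L 'b :: complex_normed_vector) set"
  where "cblinfuns = {T. \<forall>c x. blinfun_apply T (c *\<^sub>C x) = c *\<^sub>C blinfun_apply T x}"

definition is_inverse ::
    "('a :: complex_normed_vector \<Rightarrow>\<^sub>L 'b :: complex_normed_vector) \<Rightarrow> ('b \<Rightarrow>\<^sub>L 'a) \<Rightarrow> bool"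
  where "is_inverse T S \<longleftrightarrow>
    S \<in> cblinfuns \<and> S o\<^sub>L T = id_blinfun \<and> T o\<^sub>L S = id_blinfun"

definition singular ::
    "('a :: complex_normed_vector \<Rightarrow>\<^sub>L 'b :: complex_normed_vector) \<Rightarrow> bool"
  where "singular T \<longleftrightarrow> (\<nexists>S. is_inverse T S)"

definition is_projection :: "('a :: complex_normed_vector \<Rightarrow>\<^sub>L 'a) \<Rightarrow> bool"
  where "is_projection P \<longleftrightarrow> P \<in> cblinfuns \<and> P o\<^sub>L P = P"

definition op_power :: "('a :: real_normed_vector \<Rightarrow>\<^sub>L 'a) \<Rightarrow> nat \<Rightarrow> 'a \<Rightarrow>\<^sub>L 'a"
  where "op_power T j = ((\<lambda>S. T o\<^sub>L S) ^^ j) id_blinfun"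

text \<open>\<open>op_prod f m\<close> is the product f 1 o f 2 o ... o f m, in this order.\<close>

definition op_prod :: "(nat \<Rightarrow> 'a :: real_normed_vector \<Rightarrow>\<^sub>L 'a) \<Rightarrow> nat \<Rightarrow> 'a \<Rightarrow>\<^sub>L 'a"
  where "op_prod f m = foldr (\<lambda>k S. f k o\<^sub>L S) [1..<Suc m] id_blinfun"

text \<open>For projections Q on K and P on H, the bounded operators from Q(K) to P(H) are represented by
  their extensions to K that vanish on the kernel of Q. The two lemmas below show that restriction
  to Q(K) is a bijection between this set and the bounded operators from Q(K) to P(H), and that the
  operator norm on Q(K) and the norm on K are equivalent under this bijection.\<close>

definition corner_ops :: "('a :: complex_normed_vector \<Rightarrow>\<^sub>L 'a) \<Rightarrow>
    ('b :: complex_normed_vector \<Rightarrow>\<^sub>L 'b) \<Rightarrow> ('b \<Rightarrow>\<^sub>L 'a) set"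
  where "corner_ops P Q = {S \<in> cblinfuns. P o\<^sub>L S o\<^sub>L Q = S}"

lemma corner_ops_restrict:
  assumes "S \<in> corner_ops P Q"
  shows "blinfun_apply S y \<in> range (blinfun_apply P)"
    and "norm (blinfun_apply S y) \<le> norm S * norm y"
proof -
  have "blinfun_apply S y = blinfun_apply (P o\<^sub>L S o\<^sub>L Q) y"
    using assms by (simp add: corner_ops_def)
  then show "blinfun_apply S y \<in> range (blinfun_apply P)"
    by simp
  show "norm (blinfun_apply S y) \<le> norm S * norm y"
    by (rule norm_blinfun)
qed

lemma corner_ops_extend:
  fixes P :: "'a :: complex_normed_vector \<Rightarrow>\<^sub>L 'a"
    and Q :: "'b :: complex_normed_vector \<Rightarrow>\<^sub>L 'b"
  defines "N \<equiv> range (blinfun_apply Q)"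
  assumes P: "is_projection P" and Q: "is_projection Q"
    and range: "\<And>y. y \<in> N \<Longrightarrow> T y \<in> range (blinfun_apply P)"
    and add: "\<And>x y. x \<in> N \<Longrightarrow> y \<in> N \<Longrightarrow> T (x + y) = T x + T y"
    and scale: "\<And>c y. y \<in> N \<Longrightarrow> T (c *\<^sub>C y) = c *\<^sub>C T y"
    and bound: "\<And>y. y \<in> N \<Longrightarrow> norm (T y) \<le> B * norm y" and "B \<ge> 0"
  shows "\<exists>!S. S \<in> corner_ops P Q \<and> (\<forall>y\<in>N. blinfun_apply S y = T y)"
    and "S \<in> corner_ops P Q \<Longrightarrow> \<forall>y\<in>N. blinfun_apply S y = T y \<Longrightarrow> norm S \<le> B * norm Q"
proof -
  have QN [simp]: "blinfun_apply Q y \<in> N" for y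
    by (simp add: N_def)
  have QQ: "blinfun_apply Q y = y" if "y \<in> N" for y
  proof -
    from that obtain x where "y = blinfun_apply Q x" by (auto simp: N_def)
    moreover have "blinfun_apply (Q o\<^sub>L Q) x = blinfun_apply Q x"
      using Q by (simp add: is_projection_def)
    ultimately show ?thesis by simp
  qed
  have PP: "blinfun_apply P x = x" if "x \<in> range (blinfun_apply P)" for x
  proof -
    from that obtain x' where "x = blinfun_apply P x'" by auto
    moreover have "blinfun_apply (P o\<^sub>L P) x' = blinfun_apply P x'"
      using P by (simp add: is_projection_def)
    ultimately show ?thesis by simp
  qed
  have Qc: "blinfun_apply Q (c *\<^sub>C y) = c *\<^sub>C blinfun_apply Q y" for c y
    using Q by (simp add: is_projection_def cblinfuns_def)
  have bl: "bounded_linear (\<lambda>y. T (blinfun_apply Q y))"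
  proof (rule bounded_linear_intro[where K = "B * norm Q"])
    fix r :: real and x y :: 'b
    show "T (blinfun_apply Q (x + y)) = T (blinfun_apply Q x) + T (blinfun_apply Q y)"
      by (simp add: blinfun.add_right add)
    show "T (blinfun_apply Q (r *\<^sub>R x)) = r *\<^sub>R T (blinfun_apply Q x)"
      using scale[of "blinfun_apply Q x" "complex_of_real r"]
      by (simp add: blinfun.scaleR_right scaleC_of_real)
    have "norm (T (blinfun_apply Q x)) \<le> B * norm (blinfun_apply Q x)"
      by (rule bound) simp
    also have "\<dots> \<le> B * (norm Q * norm x)"
      using \<open>B \<ge> 0\<close> by (intro mult_left_mono norm_blinfun)
    finally show "norm (T (blinfun_apply Q x)) \<le> norm x * (B * norm Q)"
      by (simp add: mult_ac)
  qed
  define E where "E = Blinfun (\<lambda>y. T (blinfun_apply Q y))"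
  have E: "blinfun_apply E y = T (blinfun_apply Q y)" for y
    by (simp add: E_def bounded_linear_Blinfun_apply[OF bl])
  have "blinfun_apply E (c *\<^sub>C y) = c *\<^sub>C blinfun_apply E y" for c y
    by (simp only: E Qc scale[OF QN])
  moreover have "blinfun_apply (P o\<^sub>L E o\<^sub>L Q) y = blinfun_apply E y" for y
    by (simp only: blinfun_apply_blinfun_compose E QQ[OF QN] PP[OF range[OF QN]])
  ultimately have "E \<in> corner_ops P Q"
    unfolding corner_ops_def cblinfuns_def by (simp add: blinfun_eqI)
  moreover have "\<forall>y\<in>N. blinfun_apply E y = T y"
    by (simp add: E QQ)
  moreover have uniq: "blinfun_apply S' y = T (blinfun_apply Q y)"
    if "S' \<in> corner_ops P Q" "\<forall>y\<in>N. blinfun_apply S' y = T y" for S' y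
  proof -
    have "blinfun_apply S' y = blinfun_apply (P o\<^sub>L S' o\<^sub>L Q) y"
      using that by (simp add: corner_ops_def)
    also have "\<dots> = T (blinfun_apply Q y)"
      using that(2) QN by (simp only: blinfun_apply_blinfun_compose PP[OF range[OF QN]])
    finally show ?thesis .
  qed
  ultimately show "\<exists>!S. S \<in> corner_ops P Q \<and> (\<forall>y\<in>N. blinfun_apply S y = T y)"
    by (intro ex1I[of _ E]) (auto intro!: blinfun_eqI simp only: E uniq)
  assume S: "S \<in> corner_ops P Q" "\<forall>y\<in>N. blinfun_apply S y = T y"
  show "norm S \<le> B * norm Q"
  proof (rule norm_blinfun_bound)
    fix y
    have "norm (T (blinfun_apply Q y)) \<le> B * norm (blinfun_apply Q y)"
      by (rule bound) simp
    also have "\<dots> \<le> B * (norm Q * norm y)"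
      using \<open>B \<ge> 0\<close> by (intro mult_left_mono norm_blinfun)
    finally show "norm (blinfun_apply S y) \<le> B * norm Q * norm y"
      by (simp add: uniq[OF S] mult.assoc)
  qed (use \<open>B \<ge> 0\<close> in simp)
qed


section \<open>Analytic vector-valued functions\<close>

text \<open>These mirror the library's \<open>holomorphic_on\<close> and \<open>analytic_on\<close>, which only cover
  complex-valued functions.\<close>

definition cholomorphic_on ::
    "(complex \<Rightarrow> 'a :: complex_normed_vector) \<Rightarrow> complex set \<Rightarrow> bool" (infixl \<open>cholomorphic'_on\<close> 50)
  where "f cholomorphic_on S \<longleftrightarrow>
    (\<forall>z\<in>S. \<exists>D. (f has_derivative (\<lambda>h. h *\<^sub>C D)) (at z within S))"

definition canalytic_on ::
    "(complex \<Rightarrow> 'a :: complex_normed_vector) \<Rightarrow> complex set \<Rightarrow> bool" (infixl \<open>canalytic'_on\<close> 50)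
  where "f canalytic_on S \<longleftrightarrow> (\<forall>z\<in>S. \<exists>e>0. f cholomorphic_on ball z e)"


section \<open>Linear pencils, resolvents and basic solutions\<close>

definition pencil :: "('a :: complex_normed_vector \<Rightarrow>\<^sub>L 'b :: complex_normed_vector) \<Rightarrow>
    ('a \<Rightarrow>\<^sub>L 'b) \<Rightarrow> complex \<Rightarrow> 'a \<Rightarrow>\<^sub>L 'b"
  where "pencil A0 A1 z = A0 + z *\<^sub>C A1"

text \<open>Only meaningful at points where the pencil is not singular.\<close>

definition resolvent :: "('a :: complex_normed_vector \<Rightarrow>\<^sub>L 'b :: complex_normed_vector) \<Rightarrow>
    ('a \<Rightarrow>\<^sub>L 'b) \<Rightarrow> complex \<Rightarrow> 'b \<Rightarrow>\<^sub>L 'a"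
  where "resolvent A0 A1 z = (THE S. is_inverse (pencil A0 A1 z) S)"

text \<open>The resolvent is defined and analytic at z: defined in a whole neighbourhood of z, so that
  the arbitrary values of \<open>resolvent\<close> at singular points play no role.\<close>

definition resolvent_regular_at :: "('a :: complex_normed_vector \<Rightarrow>\<^sub>L 'b :: complex_normed_vector) \<Rightarrow>
    ('a \<Rightarrow>\<^sub>L 'b) \<Rightarrow> complex \<Rightarrow> bool"
  where "resolvent_regular_at A0 A1 z \<longleftrightarrow>
    (\<exists>e>0. (\<forall>w\<in>ball z e. \<not> singular (pencil A0 A1 w)) \<and> resolvent A0 A1 cholomorphic_on ball z e)"

definition resolvent_isolated_singularity_at ::
    "('a :: complex_normed_vector \<Rightarrow>\<^sub>L 'b :: complex_normed_vector) \<Rightarrow>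
      ('a \<Rightarrow>\<^sub>L 'b) \<Rightarrow> complex \<Rightarrow> bool"
  where "resolvent_isolated_singularity_at A0 A1 z \<longleftrightarrow>
    \<not> resolvent_regular_at A0 A1 z \<and>
    (\<exists>e>0. \<forall>w\<in>ball z e - {z}. resolvent_regular_at A0 A1 w)"

text \<open>The reciprocal of the distance from z k to the nearest of the other points z 1, ..., z m;
  it is 0 if there is no other point.\<close>

definition recip_radius :: "nat \<Rightarrow> (nat \<Rightarrow> complex) \<Rightarrow> nat \<Rightarrow> real"
  where "recip_radius m z k =
    (if m = 1 then 0 else 1 / Min ((\<lambda>j. cmod (z j - z k)) ` ({1..m} - {k})))"

text \<open>(X, Y) is the basic solution at the point c on the punctured disc of radius r around c, where
  rho = 1/r. Here X is the coefficient of order -1 and Y the coefficient of order 0.\<close>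

definition basic_solution :: "('a :: complex_normed_vector \<Rightarrow>\<^sub>L 'b :: complex_normed_vector) \<Rightarrow>
    ('a \<Rightarrow>\<^sub>L 'b) \<Rightarrow> complex \<Rightarrow> real \<Rightarrow> ('b \<Rightarrow>\<^sub>L 'a) \<Rightarrow> ('b \<Rightarrow>\<^sub>L 'a) \<Rightarrow> bool"
  where "basic_solution A0 A1 c rho X Y \<longleftrightarrow>
    X \<in> cblinfuns \<and> Y \<in> cblinfuns \<and>
    (X o\<^sub>L A1) + (Y o\<^sub>L pencil A0 A1 c) = id_blinfun \<and>
    (A1 o\<^sub>L X) + (pencil A0 A1 c o\<^sub>L Y) = id_blinfun \<and>
    (\<forall>B\<in>{pencil A0 A1 c, A1}. X o\<^sub>L B o\<^sub>L Y = 0 \<and> Y o\<^sub>L B o\<^sub>L X = 0) \<and>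
    (\<lambda>j. root j (norm (op_power (X o\<^sub>L pencil A0 A1 c) j))) \<longlonglongrightarrow> 0 \<and>
    (\<exists>l\<le>rho. (\<lambda>j. root j (norm (op_power (Y o\<^sub>L A1) j))) \<longlonglongrightarrow> l)"

end

theory Submission
  imports Defs
begin

text \<open>Each \<open>P k\<close> and \<open>Q k\<close> intertwine the pencil, so \<open>P k R(w) = R(w) Q k\<close>. Orthogonality needs no
  contour integrals: \<open>U = P k P l\<close> solves a Sylvester equation \<open>S U - U T = (z k - z l) U\<close> whose
  coefficients are the quasinilpotent operators \<open>R\<^sub>-\<^sub>1 A(z k)\<close> and \<open>R\<^sub>-\<^sub>1 A(z l)\<close> of the two basic
  solutions, which forces \<open>U = 0\<close>. The part \<open>P k R(w) Q k\<close> equals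
  \<open>(R\<^sub>-\<^sub>1 A(z k) + (w - z k))\<^sup>-\<^sup>1 R\<^sub>-\<^sub>1\<close>, which exists for all \<open>w \<noteq> z k\<close> by quasinilpotency, while
  \<open>(I - P k) R(w)\<close> equals \<open>(I + (w - z k) R\<^sub>0 A1)\<^sup>-\<^sup>1 R\<^sub>0\<close> near \<open>z k\<close>, a Neumann series; so the
  singularity at \<open>z k\<close> is removable after composition with \<open>P\<^sub>\<infinity>\<close>.\<close>

section \<open>Bounded complex-linear operators\<close>

lemma blinfun_compose_assoc: "(F o\<^sub>L G) o\<^sub>L H = F o\<^sub>L (G o\<^sub>L H)"
  by (simp add: blinfun_eqI)

lemma blinfun_compose_id [simp]: "id_blinfun o\<^sub>L F = F" "F o\<^sub>L id_blinfun = F"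
  by (simp_all add: blinfun_eqI)

lemma blinfun_compose_scaleC_left: "(a *\<^sub>C F) o\<^sub>L G = a *\<^sub>C (F o\<^sub>L G)"
  by (rule blinfun_eqI) (simp add: scaleC_blinfun.rep_eq)

text \<open>\<open>blinfun\<close> provides only real linearity; membership in
  \<open>cblinfuns\<close> lets a complex scalar pass the left factor.\<close>

lemma blinfun_compose_scaleC_right:
  "F \<in> cblinfuns \<Longrightarrow> F o\<^sub>L (a *\<^sub>C G) = a *\<^sub>C (F o\<^sub>L G)"
  by (rule blinfun_eqI) (simp add: scaleC_blinfun.rep_eq cblinfuns_def)

lemmas blinfun_compose_bilinear =
  bounded_bilinear.add_left[OF bounded_bilinear_blinfun_compose]
  bounded_bilinear.add_right[OF bounded_bilinear_blinfun_compose]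
  bounded_bilinear.diff_left[OF bounded_bilinear_blinfun_compose]
  bounded_bilinear.diff_right[OF bounded_bilinear_blinfun_compose]
  bounded_bilinear.minus_left[OF bounded_bilinear_blinfun_compose]
  bounded_bilinear.minus_right[OF bounded_bilinear_blinfun_compose]

lemmas blinfun_compose_sum_left = bounded_bilinear.sum_left[OF bounded_bilinear_blinfun_compose]
lemmas blinfun_compose_sum_right = bounded_bilinear.sum_right[OF bounded_bilinear_blinfun_compose]

lemmas compose_algebra = blinfun_compose_assoc blinfun_compose_bilinear
  blinfun_compose_scaleC_left blinfun_compose_scaleC_right

lemma scaleC_zero_left [simp]: "0 *\<^sub>C (x :: 'a :: complex_normed_vector) = 0"
  using norm_scaleC[of 0 x] by simp

lemma scaleC_zero_right [simp]: "a *\<^sub>C (0 :: 'a :: complex_normed_vector) = 0"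
  using norm_scaleC[of a "0 :: 'a"] by simp

lemma scaleC_minus_left: "(- a) *\<^sub>C (x :: 'a :: complex_normed_vector) = - (a *\<^sub>C x)"
  using scaleC_add_left[of "- a" a x] by (simp add: eq_neg_iff_add_eq_0)

lemma scaleC_diff_left:
  "(a - b) *\<^sub>C (x :: 'a :: complex_normed_vector) = a *\<^sub>C x - b *\<^sub>C x"
  using scaleC_add_left[of a "- b" x] by (simp add: scaleC_minus_left)

lemma scaleC_minus_right: "a *\<^sub>C (- x :: 'a :: complex_normed_vector) = - (a *\<^sub>C x)"
  by (rule bounded_linear.linear[OF bounded_linear_scaleC, THEN linear_neg])

lemma scaleC_diff_right:
  "a *\<^sub>C (x - y :: 'a :: complex_normed_vector) = a *\<^sub>C x - a *\<^sub>C y"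
  by (rule bounded_linear.linear[OF bounded_linear_scaleC, THEN linear_diff])

lemma cblinfuns_id [simp]: "id_blinfun \<in> cblinfuns"
  by (simp add: cblinfuns_def)

lemma cblinfuns_zero [simp]: "0 \<in> cblinfuns"
  by (simp add: cblinfuns_def)

lemma cblinfuns_add [simp]: "F \<in> cblinfuns \<Longrightarrow> G \<in> cblinfuns \<Longrightarrow> F + G \<in> cblinfuns"
  by (simp add: cblinfuns_def blinfun.add_left scaleC_add_right)

lemma cblinfuns_diff [simp]: "F \<in> cblinfuns \<Longrightarrow> G \<in> cblinfuns \<Longrightarrow> F - G \<in> cblinfuns"
  by (simp add: cblinfuns_def blinfun.diff_left scaleC_diff_right)

lemma cblinfuns_scaleC [simp]: "F \<in> cblinfuns \<Longrightarrow> a *\<^sub>C F \<in> cblinfuns"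
  by (simp add: cblinfuns_def scaleC_blinfun.rep_eq scaleC_scaleC mult.commute)

lemma cblinfuns_compose [simp]: "F \<in> cblinfuns \<Longrightarrow> G \<in> cblinfuns \<Longrightarrow> F o\<^sub>L G \<in> cblinfuns"
  by (simp add: cblinfuns_def)

lemma cblinfuns_sum: "(\<And>i. i \<in> I \<Longrightarrow> F i \<in> cblinfuns) \<Longrightarrow> sum F I \<in> cblinfuns"
  by (induction I rule: infinite_finite_induct) simp_all

lemma cblinfuns_pencil [simp]:
  "A0 \<in> cblinfuns \<Longrightarrow> A1 \<in> cblinfuns \<Longrightarrow> pencil A0 A1 w \<in> cblinfuns"
  by (simp add: pencil_def)

lemma pencil_shift: "pencil A0 A1 w = pencil A0 A1 c + (w - c) *\<^sub>C A1"
  by (simp add: pencil_def scaleC_diff_left)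

text \<open>A two-sided inverse is automatically complex-linear: \<open>T\<close> maps
  \<open>a *\<^sub>C S y\<close> to \<open>a *\<^sub>C y\<close>, and \<open>S\<close> takes this
  back.\<close>

lemma is_inverseI:
  assumes "T \<in> cblinfuns" "S o\<^sub>L T = id_blinfun" "T o\<^sub>L S = id_blinfun"
  shows "is_inverse T S"
proof -
  have TS: "blinfun_apply T (blinfun_apply S y) = y" for y
    using arg_cong[OF assms(3), of "\<lambda>F. blinfun_apply F y"] by simp
  have ST: "blinfun_apply S (blinfun_apply T y) = y" for y
    using arg_cong[OF assms(2), of "\<lambda>F. blinfun_apply F y"] by simp
  have "blinfun_apply S (a *\<^sub>C y) = a *\<^sub>C blinfun_apply S y" for a y
  proof -
    have "blinfun_apply S (a *\<^sub>C blinfun_apply T (blinfun_apply S y))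
        = blinfun_apply S (blinfun_apply T (a *\<^sub>C blinfun_apply S y))"
      using assms(1) by (simp add: cblinfuns_def)
    then show ?thesis by (simp add: TS ST)
  qed
  then show ?thesis using assms by (simp add: is_inverse_def cblinfuns_def)
qed

lemma is_inverse_unique:
  assumes "is_inverse T S" "is_inverse T S'"
  shows "S = S'"
proof -
  have "S = S o\<^sub>L (T o\<^sub>L S')" using assms by (simp add: is_inverse_def)
  also have "\<dots> = (S o\<^sub>L T) o\<^sub>L S'" by (rule blinfun_compose_assoc[symmetric])
  also have "\<dots> = S'" using assms by (simp add: is_inverse_def)
  finally show ?thesis .
qed

lemma is_inverse_resolvent:
  assumes "\<not> singular (pencil A0 A1 w)"
  shows "is_inverse (pencil A0 A1 w) (resolvent A0 A1 w)"
proof -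
  obtain S where S: "is_inverse (pencil A0 A1 w) S"
    using assms unfolding singular_def by blast
  show ?thesis
    unfolding resolvent_def by (rule theI[of _ S]) (rule S, rule is_inverse_unique[OF _ S])
qed

lemma is_inverse_scaleC:
  assumes "is_inverse T S" "T \<in> cblinfuns" "a \<noteq> 0"
  shows "is_inverse (a *\<^sub>C T) (inverse a *\<^sub>C S)"
  using assms by (auto simp: is_inverse_def compose_algebra scaleC_scaleC scaleC_one)


section \<open>Neumann series and quasinilpotent operators\<close>

lemma op_power_0 [simp]: "op_power T 0 = id_blinfun"
  by (simp add: op_power_def)

lemma op_power_Suc [simp]: "op_power T (Suc j) = T o\<^sub>L op_power T j"
  by (simp add: op_power_def)

lemma op_power_Suc_right: "op_power T (Suc j) = op_power T j o\<^sub>L T"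
proof (induction j)
  case (Suc j)
  then show ?case by (metis op_power_Suc blinfun_compose_assoc)
qed simp

lemma op_power_scaleC: "T \<in> cblinfuns \<Longrightarrow> op_power (a *\<^sub>C T) j = a ^ j *\<^sub>C op_power T j"
  by (induction j) (simp_all add: scaleC_one compose_algebra scaleC_scaleC)

lemma norm_op_power: "norm (op_power T j) \<le> norm T ^ j"
proof (induction j)
  case 0
  show ?case by (simp add: norm_blinfun_id_le)
next
  case (Suc j)
  have "norm (op_power T (Suc j)) \<le> norm T * norm (op_power T j)"
    by (simp add: norm_blinfun_compose)
  also have "\<dots> \<le> norm T ^ Suc j"
    using Suc by (simp add: mult_left_mono)
  finally show ?case .
qed

text \<open>Summable power norms, instead of \<open>norm T < 1\<close>, also cover quasinilpotent
  operators of large norm. Shifting the index gives \<open>T E = E T = E - I\<close>.\<close>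

lemma neumann_series:
  fixes T :: "'a :: complex_banach \<Rightarrow>\<^sub>L 'a"
  assumes T: "T \<in> cblinfuns" and summable: "summable (\<lambda>j. norm (op_power T j))"
  shows "\<exists>S. is_inverse (id_blinfun - T) S"
proof -
  define E where "E = (\<Sum>j. op_power T j)"
  have s: "summable (op_power T)"
    by (rule summable_norm_cancel[OF summable])
  have split: "E = id_blinfun + (\<Sum>j. op_power T (Suc j))"
    unfolding E_def using suminf_split_head[OF s] by simp
  have "T o\<^sub>L E = (\<Sum>j. T o\<^sub>L op_power T j)" unfolding E_def
    by (rule bounded_linear.suminf[OF bounded_bilinear.bounded_linear_right
          [OF bounded_bilinear_blinfun_compose] s])
  then have TE: "T o\<^sub>L E = E - id_blinfun"
    using split by simp
  have "E o\<^sub>L T = (\<Sum>j. op_power T j o\<^sub>L T)" unfolding E_def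
    by (rule bounded_linear.suminf[OF bounded_bilinear.bounded_linear_left
          [OF bounded_bilinear_blinfun_compose] s])
  then have ET: "E o\<^sub>L T = E - id_blinfun"
    using split by (simp only: op_power_Suc_right) simp
  have "is_inverse (id_blinfun - T) E"
    using T by (intro is_inverseI) (simp_all add: blinfun_compose_bilinear TE ET)
  then show ?thesis ..
qed

text \<open>Spectral radius 0 in the form of Gelfand's formula, as \<open>basic_solution\<close>
  imposes it on \<open>X o\<^sub>L pencil A0 A1 c\<close>.\<close>

definition quasinilpotent :: "('a :: real_normed_vector \<Rightarrow>\<^sub>L 'a) \<Rightarrow> bool"
  where "quasinilpotent T \<longleftrightarrow> (\<lambda>j. root j (norm (op_power T j))) \<longlonglongrightarrow> 0"

lemma quasinilpotent_eventually:
  assumes "quasinilpotent T" "e > 0"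
  shows "\<forall>\<^sub>F j in sequentially. norm (op_power T j) \<le> e ^ j"
proof -
  have "\<forall>\<^sub>F j in sequentially. root j (norm (op_power T j)) < e"
    using assms unfolding quasinilpotent_def by (auto dest: order_tendstoD)
  \<comment> \<open>Index 0 is excluded because \<open>root 0 x = 0\<close>, whose power does not
    recover \<open>x\<close>.\<close>
  with eventually_gt_at_top[of "0 :: nat"] show ?thesis
  proof eventually_elim
    case (elim j)
    have "norm (op_power T j) = root j (norm (op_power T j)) ^ j"
      using elim by simp
    also have "\<dots> \<le> e ^ j"
      using elim by (intro power_mono) (simp_all add: real_root_ge_zero)
    finally show ?case .
  qed
qed

text \<open>Write \<open>T + s\<close> as \<open>s (I - T')\<close> with
  \<open>T' = - T / s\<close>. However small \<open>s\<close> is, quasinilpotency eventually bounds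
  the powers of \<open>T'\<close> by \<open>(1/2)^j\<close>, so the Neumann series
  converges.\<close>

lemma quasinilpotent_shift_invertible:
  fixes T :: "'a :: complex_banach \<Rightarrow>\<^sub>L 'a"
  assumes T: "T \<in> cblinfuns" and q: "quasinilpotent T" and s: "s \<noteq> 0"
  shows "\<exists>S. is_inverse (T + s *\<^sub>C id_blinfun) S"
proof -
  define T' where "T' = (- inverse s) *\<^sub>C T"
  have T': "T' \<in> cblinfuns" using T by (simp add: T'_def)
  have "\<forall>\<^sub>F j in sequentially. norm (op_power T j) \<le> (cmod s / 2) ^ j"
    using s by (intro quasinilpotent_eventually q) simp
  then have "\<forall>\<^sub>F j in sequentially. norm (norm (op_power T' j)) \<le> (1/2) ^ j"
  proof eventually_elim
    case (elim j)
    have "norm (op_power T' j) = inverse (cmod s) ^ j * norm (op_power T j)"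
      by (simp add: T'_def op_power_scaleC T norm_scaleC norm_power norm_inverse)
    also have "\<dots> \<le> inverse (cmod s) ^ j * (cmod s / 2) ^ j"
      using elim by (intro mult_left_mono) auto
    also have "\<dots> = (1/2) ^ j"
      using s by (simp add: field_simps flip: power_mult_distrib)
    finally show ?case by simp
  qed
  then have "summable (\<lambda>j. norm (op_power T' j))"
    by (rule summable_comparison_test_ev) (simp add: summable_geometric)
  then obtain S where "is_inverse (id_blinfun - T') S"
    using neumann_series[OF T'] by blast
  then have "is_inverse (s *\<^sub>C (id_blinfun - T')) (inverse s *\<^sub>C S)"
    using T' s by (intro is_inverse_scaleC) auto
  moreover have "s *\<^sub>C (id_blinfun - T') = T + s *\<^sub>C id_blinfun"
    using s by (simp add: T'_def scaleC_add_right scaleC_scaleC scaleC_minus_left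
        scaleC_one)
  ultimately show ?thesis by auto
qed

text \<open>The small-norm case, meant for \<open>Y o\<^sub>L A1\<close> near the centre
  \<open>c\<close>, an operator that need not be quasinilpotent.\<close>

lemma id_add_invertible:
  fixes T :: "'a :: complex_banach \<Rightarrow>\<^sub>L 'a"
  assumes T: "T \<in> cblinfuns" and s: "cmod s * norm T < 1"
  shows "\<exists>S. is_inverse (id_blinfun + s *\<^sub>C T) S"
proof -
  define T' where "T' = (- s) *\<^sub>C T"
  have "summable (\<lambda>j. norm (op_power T' j))"
  proof (rule summable_comparison_test_ev)
    show "\<forall>\<^sub>F j in sequentially. norm (norm (op_power T' j)) \<le> norm T' ^ j"
      by (simp add: norm_op_power)
    show "summable (\<lambda>j. norm T' ^ j)"
      using s by (intro summable_geometric) (simp add: T'_def norm_scaleC)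
  qed
  then have "\<exists>S. is_inverse (id_blinfun - T') S"
    using T by (intro neumann_series) (simp_all add: T'_def)
  then show ?thesis by (simp add: T'_def scaleC_minus_left)
qed

text \<open>A Rosenblum-type uniqueness result for a Sylvester equation: with \<open>V\<close> the inverse of
  \<open>S - a\<close>, the equation iterates to \<open>U = V\<^sup>j U T\<^sup>j\<close>.\<close>

lemma quasinilpotent_sylvester_zero:
  fixes S :: "'a :: complex_banach \<Rightarrow>\<^sub>L 'a" and T :: "'b :: complex_normed_vector \<Rightarrow>\<^sub>L 'b"
  assumes S: "S \<in> cblinfuns" "quasinilpotent S" and T: "quasinilpotent T" and a: "a \<noteq> 0"
    and eq: "(S o\<^sub>L U) - (U o\<^sub>L T) = a *\<^sub>C U"
  shows "U = 0"
proof -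
  obtain V where "is_inverse (S + (- a) *\<^sub>C id_blinfun) V"
    using quasinilpotent_shift_invertible[OF S, of "- a"] a by auto
  then have V: "V o\<^sub>L (S - a *\<^sub>C id_blinfun) = id_blinfun"
    by (simp add: is_inverse_def scaleC_minus_left)
  have "(S - a *\<^sub>C id_blinfun) o\<^sub>L U = U o\<^sub>L T"
    using eq by (simp add: compose_algebra algebra_simps)
  then have U: "U = V o\<^sub>L (U o\<^sub>L T)"
    using V by (metis blinfun_compose_assoc blinfun_compose_id(1))
  have iter: "U = op_power V j o\<^sub>L (U o\<^sub>L op_power T j)" for j
  proof (induction j)
    case (Suc j)
    have "U = op_power V j o\<^sub>L ((V o\<^sub>L (U o\<^sub>L T)) o\<^sub>L op_power T j)"
      using Suc U by simp
    also have "\<dots> = (op_power V j o\<^sub>L V) o\<^sub>L (U o\<^sub>L (T o\<^sub>L op_power T j))"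
      by (simp add: blinfun_compose_assoc)
    finally show ?case by (simp only: op_power_Suc_right[of V] op_power_Suc[of T])
  qed simp
  \<comment> \<open>Chosen so that \<open>norm V * e \<le> 1/2\<close>; the added 1 keeps
    \<open>e\<close> positive when \<open>V = 0\<close>.\<close>
  define e where "e = inverse (2 * (norm V + 1))"
  have e: "e > 0" "norm V * e \<le> 1/2"
    using norm_ge_zero[of V] by (simp_all add: e_def field_simps add_pos_nonneg)
  \<comment> \<open>A single index \<open>j \<ge> 1\<close> suffices: the chain below then ends in
    \<open>norm U \<le> norm U / 2\<close>.\<close>
  have "\<forall>\<^sub>F j in sequentially. norm (op_power T j) \<le> e ^ j \<and> j \<ge> 1"
    by (intro eventually_conj quasinilpotent_eventually T e eventually_ge_at_top)
  then obtain j where j: "norm (op_power T j) \<le> e ^ j" "j \<ge> 1"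
    by (auto simp: eventually_sequentially)
  have "norm U \<le> norm (op_power V j) * norm (U o\<^sub>L op_power T j)"
    by (subst iter[of j]) (rule norm_blinfun_compose)
  also have "\<dots> \<le> norm V ^ j * (norm U * e ^ j)"
    using j e by (intro mult_mono norm_op_power
        order_trans[OF norm_blinfun_compose] mult_left_mono) auto
  also have "\<dots> = (norm V * e) ^ j * norm U"
    by (simp add: power_mult_distrib)
  also have "\<dots> \<le> (1/2) ^ j * norm U"
    using e by (intro mult_right_mono power_mono) auto
  also have "\<dots> \<le> (1/2) ^ 1 * norm U"
    using j by (intro mult_right_mono power_decreasing) auto
  finally show "U = 0" by simp
qed


section \<open>Holomorphic operator-valued functions\<close>

lemma cholomorphic_on_subset:
  "F cholomorphic_on S \<Longrightarrow> T \<subseteq> S \<Longrightarrow> F cholomorphic_on T"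
  unfolding cholomorphic_on_def by (blast intro: has_derivative_subset)

lemma cholomorphic_on_cong:
  assumes "\<And>w. w \<in> S \<Longrightarrow> F w = G w" "F cholomorphic_on S"
  shows "G cholomorphic_on S"
  unfolding cholomorphic_on_def
proof
  fix w assume w: "w \<in> S"
  with assms(2) obtain D where "(F has_derivative (\<lambda>h. h *\<^sub>C D)) (at w within S)"
    by (auto simp: cholomorphic_on_def)
  then have "(G has_derivative (\<lambda>h. h *\<^sub>C D)) (at w within S)"
    by (rule has_derivative_transform[OF w, rotated]) (simp add: assms(1))
  then show "\<exists>D. (G has_derivative (\<lambda>h. h *\<^sub>C D)) (at w within S)" ..
qed

lemma canalytic_onI_open:
  assumes "open S" "F cholomorphic_on S"
  shows "F canalytic_on S"
  unfolding canalytic_on_def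
proof
  fix w assume "w \<in> S"
  with assms(1) obtain e where "e > 0" "ball w e \<subseteq> S"
    by (auto simp: open_contains_ball)
  then show "\<exists>e>0. F cholomorphic_on ball w e"
    using cholomorphic_on_subset[OF assms(2)] by blast
qed

text \<open>Differentiation commutes with the bounded linear map that sends \<open>G\<close> to
  \<open>L G M\<close>; complex linearity of \<open>L\<close> keeps the derivative in the form
  \<open>h *\<^sub>C D\<close>.\<close>

lemma cholomorphic_on_compose_const:
  fixes F :: "complex \<Rightarrow> 'b :: complex_normed_vector \<Rightarrow>\<^sub>L 'c :: complex_normed_vector"
    and L :: "'c \<Rightarrow>\<^sub>L 'd :: complex_normed_vector" and M :: "'a :: complex_normed_vector \<Rightarrow>\<^sub>L 'b"
  assumes "F cholomorphic_on S" "L \<in> cblinfuns"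
  shows "(\<lambda>w. L o\<^sub>L F w o\<^sub>L M) cholomorphic_on S"
  unfolding cholomorphic_on_def
proof
  fix w assume "w \<in> S"
  with assms(1) obtain D where D: "(F has_derivative (\<lambda>h. h *\<^sub>C D)) (at w within S)"
    by (auto simp: cholomorphic_on_def)
  have "bounded_linear (\<lambda>G. L o\<^sub>L G o\<^sub>L M)"
    by (rule bounded_linear_compose
        [OF bounded_bilinear.bounded_linear_left[OF bounded_bilinear_blinfun_compose]
          bounded_bilinear.bounded_linear_right[OF bounded_bilinear_blinfun_compose]])
  from bounded_linear.has_derivative[OF this D]
  have "((\<lambda>w. L o\<^sub>L F w o\<^sub>L M) has_derivative (\<lambda>h. h *\<^sub>C (L o\<^sub>L D o\<^sub>L M))) (at w within S)"
    using assms(2) by (simp add: compose_algebra)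
  then show "\<exists>D. ((\<lambda>w. L o\<^sub>L F w o\<^sub>L M) has_derivative (\<lambda>h. h *\<^sub>C D)) (at w within S)" ..
qed

text \<open>The resolvent identity \<open>V u - V w = - (u - w) V u G1 V w\<close> first bounds
  \<open>V\<close> near \<open>w\<close>, then makes it continuous there, then yields the derivative
  \<open>- V w G1 V w\<close>.\<close>

lemma cholomorphic_on_pencil_inverse:
  fixes G0 G1 :: "'a :: complex_normed_vector \<Rightarrow>\<^sub>L 'b :: complex_normed_vector"
  assumes G1: "G1 \<in> cblinfuns"
    and inv: "\<And>w. w \<in> S \<Longrightarrow> is_inverse (pencil G0 G1 w) (V w)"
  shows "V cholomorphic_on S"
  unfolding cholomorphic_on_def
proof
  fix w assume w: "w \<in> S"
  define K where "K = norm (V w)"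
  define L where "L = norm G1"
  have cl: "V u \<in> cblinfuns" if "u \<in> S" for u
    using inv[OF that] by (simp add: is_inverse_def)
  have diff: "V u - V w = - ((u - w) *\<^sub>C (V u o\<^sub>L (G1 o\<^sub>L V w)))" if u: "u \<in> S" for u
  proof -
    have "V u o\<^sub>L (pencil G0 G1 w o\<^sub>L V w) = V u"
      and "V u o\<^sub>L (pencil G0 G1 u o\<^sub>L V w) = V w"
      using inv[OF u] inv[OF w] by (simp_all add: is_inverse_def flip: blinfun_compose_assoc)
    moreover have "V u o\<^sub>L (pencil G0 G1 u o\<^sub>L V w)
        = (V u o\<^sub>L (pencil G0 G1 w o\<^sub>L V w)) + (u - w) *\<^sub>C (V u o\<^sub>L (G1 o\<^sub>L V w))"
      by (subst pencil_shift[of _ _ u w]) (simp add: compose_algebra cl[OF u])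
    ultimately show ?thesis by (metis add_diff_cancel_left' minus_diff_eq)
  qed
  have nVGV: "norm (F o\<^sub>L (G1 o\<^sub>L V w)) \<le> norm F * (L * K)" for F :: "'b \<Rightarrow>\<^sub>L 'a"
    using norm_blinfun_compose[of F "G1 o\<^sub>L V w"]
      mult_left_mono[OF norm_blinfun_compose[of G1 "V w"] norm_ge_zero[of F]]
    unfolding L_def K_def by linarith
  have LK: "L * K \<ge> 0" by (simp add: L_def K_def)
  \<comment> \<open>Within this radius the identity gives
    \<open>norm (V u) \<le> K + norm (V u) / 2\<close>, hence
    \<open>norm (V u) \<le> 2 * K\<close>.\<close>
  define e where "e = inverse (2 * (L * K + 1))"
  have e: "e > 0" "e * (L * K) \<le> 1/2"
    using LK by (simp_all add: e_def field_simps add_pos_nonneg)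
  have bound: "norm (V u - V w) \<le> cmod (u - w) * (2 * K * (L * K))"
    if u: "u \<in> S" "dist u w < e" for u
  proof -
    have le: "norm (V u - V w) \<le> cmod (u - w) * (norm (V u) * (L * K))"
      using nVGV[of "V u"] by (simp add: diff[OF u(1)] norm_scaleC mult_left_mono)
    have "norm (V u) \<le> K + norm (V u - V w)"
      unfolding K_def by (metis norm_triangle_sub)
    also note le
    also have "cmod (u - w) * (norm (V u) * (L * K)) \<le> e * (norm (V u) * (L * K))"
      using u LK by (intro mult_right_mono) (auto simp: dist_norm)
    also have "\<dots> = norm (V u) * (e * (L * K))" by simp
    also have "\<dots> \<le> norm (V u) * (1/2)"
      using e by (intro mult_left_mono) auto
    finally have "norm (V u) \<le> 2 * K" by simp
    then have "cmod (u - w) * (norm (V u) * (L * K)) \<le> cmod (u - w) * (2 * K * (L * K))"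
      using LK by (intro mult_left_mono mult_right_mono) auto
    with le show ?thesis by linarith
  qed
  define D where "D = - (V w o\<^sub>L (G1 o\<^sub>L V w))"
  have "(V has_derivative (\<lambda>h. h *\<^sub>C D)) (at w within S)"
  proof (rule has_derivativeI_sandwich[OF e(1)])
    show "bounded_linear (\<lambda>h. h *\<^sub>C D)"
    proof (rule bounded_linear_intro[where K = "norm D"])
      fix x y :: complex and r :: real
      show "(x + y) *\<^sub>C D = x *\<^sub>C D + y *\<^sub>C D" by (rule scaleC_add_left)
      show "(r *\<^sub>R x) *\<^sub>C D = r *\<^sub>R (x *\<^sub>C D)"
        by (simp add: scaleR_conv_of_real scaleC_scaleC flip: scaleC_of_real)
      show "norm (x *\<^sub>C D) \<le> norm x * norm D" by (simp add: norm_scaleC)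
    qed
    show "((\<lambda>u. cmod (u - w) * (2 * K * (L * K) * (L * K))) \<longlongrightarrow> 0) (at w within S)"
      by (auto intro!: tendsto_eq_intros)
    fix u assume u: "u \<in> S" "u \<noteq> w" "dist u w < e"
    \<comment> \<open>Both terms share the right factor \<open>G1 V w\<close>, so the remainder is
      controlled by \<open>V u - V w\<close>, already of order \<open>u - w\<close>.\<close>
    have "V u - V w - (u - w) *\<^sub>C D = - ((u - w) *\<^sub>C (V u o\<^sub>L (G1 o\<^sub>L V w))) - (u - w) *\<^sub>C D"
      by (simp only: diff[OF u(1)])
    also have "\<dots> = - ((u - w) *\<^sub>C ((V u - V w) o\<^sub>L (G1 o\<^sub>L V w)))"
      by (simp add: D_def scaleC_minus_right scaleC_diff_right blinfun_compose_bilinear)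
    finally have "V u - V w - (u - w) *\<^sub>C D = - ((u - w) *\<^sub>C ((V u - V w) o\<^sub>L (G1 o\<^sub>L V w)))" .
    then have "norm (V u - V w - (u - w) *\<^sub>C D) / norm (u - w)
        = norm ((V u - V w) o\<^sub>L (G1 o\<^sub>L V w))"
      using u by (simp add: norm_scaleC)
    also have "\<dots> \<le> norm (V u - V w) * (L * K)" by (rule nVGV)
    also have "\<dots> \<le> cmod (u - w) * (2 * K * (L * K)) * (L * K)"
      by (rule mult_right_mono[OF bound[OF u(1,3)] LK])
    finally show "norm (V u - V w - (u - w) *\<^sub>C D) / norm (u - w)
        \<le> cmod (u - w) * (2 * K * (L * K) * (L * K))" by (simp add: mult.assoc)
  qed
  then show "\<exists>D. (V has_derivative (\<lambda>h. h *\<^sub>C D)) (at w within S)" ..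
qed


section \<open>Families of orthogonal projections\<close>

text \<open>The leftmost factor \<open>I - P k\<close> meets \<open>I\<close> minus the sum over the
  later indices; \<open>P k\<close> kills that sum, so no cross terms arise.\<close>

lemma foldr_id_minus_orthogonal:
  assumes "distinct ks" "\<And>k l. k \<in> set ks \<Longrightarrow> l \<in> set ks \<Longrightarrow> k \<noteq> l \<Longrightarrow> P k o\<^sub>L P l = 0"
  shows "foldr (\<lambda>k S. (id_blinfun - P k) o\<^sub>L S) ks id_blinfun = id_blinfun - (\<Sum>k\<in>set ks. P k)"
  using assms
proof (induction ks)
  case (Cons k ks)
  have "P k o\<^sub>L (\<Sum>l\<in>set ks. P l) = (\<Sum>l\<in>set ks. P k o\<^sub>L P l)"
    by (rule blinfun_compose_sum_right)
  also have "\<dots> = 0"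
    using Cons.prems by (intro sum.neutral) auto
  finally have "P k o\<^sub>L (\<Sum>l\<in>set ks. P l) = 0" .
  moreover have "foldr (\<lambda>k S. (id_blinfun - P k) o\<^sub>L S) ks id_blinfun
      = id_blinfun - (\<Sum>k\<in>set ks. P k)"
    using Cons.prems by (intro Cons.IH) auto
  then have "foldr (\<lambda>k S. (id_blinfun - P k) o\<^sub>L S) (k # ks) id_blinfun
      = (id_blinfun - P k) o\<^sub>L (id_blinfun - (\<Sum>k\<in>set ks. P k))"
    by (simp only: foldr.simps o_apply)
  ultimately show ?case
    using Cons.prems by (simp add: blinfun_compose_bilinear algebra_simps)
qed simp

lemma op_prod_id_minus_orthogonal:
  assumes "\<And>k l. k \<in> {1..m} \<Longrightarrow> l \<in> {1..m} \<Longrightarrow> k \<noteq> l \<Longrightarrow> P k o\<^sub>L P l = 0"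
  shows "op_prod (\<lambda>k. id_blinfun - P k) m = id_blinfun - (\<Sum>k=1..m. P k)"
proof -
  have "set [1..<Suc m] = {1..m}" by (auto simp del: upt_Suc)
  then show ?thesis
    unfolding op_prod_def using foldr_id_minus_orthogonal[of "[1..<Suc m]" P] assms
    by (simp del: upt_Suc)
qed

text \<open>Multiplying the sum by \<open>P i\<close> on either side leaves only \<open>P i\<close>,
  so \<open>E\<close> and \<open>P i\<close> annihilate each other. Summing over \<open>i\<close>
  gives \<open>E E = E\<close>.\<close>

lemma orthogonal_id_minus_sum:
  assumes "finite I" "\<And>i. i \<in> I \<Longrightarrow> is_projection (P i)"
    "\<And>i j. i \<in> I \<Longrightarrow> j \<in> I \<Longrightarrow> i \<noteq> j \<Longrightarrow> P i o\<^sub>L P j = 0"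
  defines "E \<equiv> id_blinfun - (\<Sum>i\<in>I. P i)"
  shows "i \<in> I \<Longrightarrow> P i o\<^sub>L E = 0" "i \<in> I \<Longrightarrow> E o\<^sub>L P i = 0" "is_projection E"
proof -
  have "P i o\<^sub>L (\<Sum>j\<in>I. P j) = P i" "(\<Sum>j\<in>I. P j) o\<^sub>L P i = P i" if "i \<in> I" for i
  proof -
    have "P i o\<^sub>L (\<Sum>j\<in>I. P j) = (\<Sum>j\<in>I. if j = i then P i else 0)"
      unfolding blinfun_compose_sum_right
      using assms that by (intro sum.cong) (auto simp: is_projection_def)
    moreover have "(\<Sum>j\<in>I. P j) o\<^sub>L P i = (\<Sum>j\<in>I. if j = i then P i else 0)"
      unfolding blinfun_compose_sum_left
      using assms that by (intro sum.cong) (auto simp: is_projection_def)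
    ultimately show "P i o\<^sub>L (\<Sum>j\<in>I. P j) = P i" "(\<Sum>j\<in>I. P j) o\<^sub>L P i = P i"
      using that \<open>finite I\<close> by simp_all
  qed
  then show PE: "P i o\<^sub>L E = 0" and "E o\<^sub>L P i = 0" if "i \<in> I" for i
    using that by (simp_all add: E_def blinfun_compose_bilinear)
  have "(\<Sum>i\<in>I. P i) o\<^sub>L E = 0"
    unfolding blinfun_compose_sum_left using PE by (intro sum.neutral) auto
  then have "E o\<^sub>L E = E"
    by (subst E_def) (simp add: blinfun_compose_bilinear)
  moreover have "E \<in> cblinfuns"
    unfolding E_def using assms(2) by (intro cblinfuns_diff cblinfuns_sum) (auto simp: is_projection_def)
  ultimately show "is_projection E" by (simp add: is_projection_def)
qed

text \<open>As the fixed-point set of a continuous linear operator, the range is visibly a closed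
  subspace.\<close>

lemma range_projection:
  "is_projection P \<Longrightarrow> range (blinfun_apply P) = {x. blinfun_apply P x = x}"
  by (auto simp: is_projection_def) (metis blinfun_apply_blinfun_compose, metis rangeI)

text \<open>The component of \<open>x\<close> in summand \<open>i\<close> can only be
  \<open>P i x\<close>: applying \<open>P i\<close> to any decomposition of \<open>x\<close> removes
  the other terms by orthogonality.\<close>

lemma direct_sum_projections:
  assumes fin: "finite I" and proj: "\<And>i. i \<in> I \<Longrightarrow> is_projection (P i)"
    and orth: "\<And>i j. i \<in> I \<Longrightarrow> j \<in> I \<Longrightarrow> i \<noteq> j \<Longrightarrow> P i o\<^sub>L P j = 0"
    and sum: "(\<Sum>i\<in>I. P i) = id_blinfun"
  shows "direct_sum I (\<lambda>i. range (blinfun_apply (P i)))"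
  unfolding direct_sum_def
proof (intro conjI ballI allI fin)
  fix i assume i: "i \<in> I"
  have r: "range (blinfun_apply (P i)) = {x. blinfun_apply (P i) x = x}"
    by (rule range_projection[OF proj[OF i]])
  show "csubspace (range (blinfun_apply (P i)))"
    unfolding r using proj[OF i]
    by (auto simp: csubspace_def blinfun.add_right is_projection_def cblinfuns_def)
  show "closed (range (blinfun_apply (P i)))"
    unfolding r by (intro closed_Collect_eq continuous_intros)
next
  fix x
  show "\<exists>!f. f \<in> (\<Pi>\<^sub>E i\<in>I. range (blinfun_apply (P i))) \<and> x = (\<Sum>i\<in>I. f i)"
  proof (rule ex1I[of _ "restrict (\<lambda>i. blinfun_apply (P i) x) I"])
    have "x = blinfun_apply (\<Sum>i\<in>I. P i) x" by (simp add: sum)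
    then show "restrict (\<lambda>i. blinfun_apply (P i) x) I \<in> (\<Pi>\<^sub>E i\<in>I. range (blinfun_apply (P i))) \<and>
        x = (\<Sum>i\<in>I. restrict (\<lambda>i. blinfun_apply (P i) x) I i)"
      by (simp add: blinfun.sum_left)
  next
    fix f assume f: "f \<in> (\<Pi>\<^sub>E i\<in>I. range (blinfun_apply (P i))) \<and> x = (\<Sum>i\<in>I. f i)"
    have fj: "blinfun_apply (P j) (f j) = f j" if "j \<in> I" for j
    proof -
      have "f j \<in> range (blinfun_apply (P j))" using f that by auto
      then show ?thesis unfolding range_projection[OF proj[OF that]] by simp
    qed
    have "blinfun_apply (P i) x = f i" if i: "i \<in> I" for i
    proof -
      have "blinfun_apply (P i) x = (\<Sum>j\<in>I. blinfun_apply (P i) (f j))"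
        using f by (simp add: blinfun.sum_right)
      also have "\<dots> = (\<Sum>j\<in>I. if j = i then f i else 0)"
      proof (intro sum.cong refl)
        fix j assume j: "j \<in> I"
        have eq: "blinfun_apply (P i) (f j) = blinfun_apply (P i o\<^sub>L P j) (f j)"
          by (simp add: fj j)
        show "blinfun_apply (P i) (f j) = (if j = i then f i else 0)"
        proof (cases "j = i")
          case True
          then show ?thesis by (simp add: fj i)
        next
          case False
          with orth[OF i j] show ?thesis unfolding eq by simp
        qed
      qed
      finally show ?thesis using fin i by simp
    qed
    then show "f = restrict (\<lambda>i. blinfun_apply (P i) x) I"
      using f by (intro extensionalityI[of _ I]) (auto simp: PiE_def)
  qed
qed

text \<open>\<open>None\<close> indexes the complementary projection, which completes the family to
  one with sum \<open>I\<close>.\<close>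

lemma direct_sum_projections_complement:
  assumes "finite I" "\<And>i. i \<in> I \<Longrightarrow> is_projection (P i)"
    "\<And>i j. i \<in> I \<Longrightarrow> j \<in> I \<Longrightarrow> i \<noteq> j \<Longrightarrow> P i o\<^sub>L P j = 0"
    and E: "E = id_blinfun - (\<Sum>i\<in>I. P i)"
  shows "direct_sum (insert None (Some ` I))
    (\<lambda>i. case i of Some k \<Rightarrow> range (blinfun_apply (P k)) | None \<Rightarrow> range (blinfun_apply E))"
proof -
  define P' where "P' i = (case i of Some k \<Rightarrow> P k | None \<Rightarrow> E)" for i
  note E_props = orthogonal_id_minus_sum[where P = P, OF assms(1-3), folded E]
  have "(\<Sum>i\<in>insert None (Some ` I). P' i) = P' None + (\<Sum>i\<in>Some ` I. P' i)"
    using assms(1) by (intro sum.insert) auto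
  also have "(\<Sum>i\<in>Some ` I. P' i) = (\<Sum>i\<in>I. P i)"
    by (subst sum.reindex) (auto simp: P'_def)
  finally have "(\<Sum>i\<in>insert None (Some ` I). P' i) = id_blinfun"
    by (simp add: P'_def E)
  then have "direct_sum (insert None (Some ` I)) (\<lambda>i. range (blinfun_apply (P' i)))"
  proof (intro direct_sum_projections)
    show "is_projection (P' i)" if "i \<in> insert None (Some ` I)" for i
      using that assms(2) E_props by (auto simp: P'_def)
    show "P' i o\<^sub>L P' j = 0"
      if "i \<in> insert None (Some ` I)" "j \<in> insert None (Some ` I)" "i \<noteq> j" for i j
      using that assms(3) E_props by (cases i; cases j) (auto simp: P'_def)
  qed (simp_all add: assms(1))
  moreover have "(\<lambda>i. range (blinfun_apply (P' i)))
      = (\<lambda>i. case i of Some k \<Rightarrow> range (blinfun_apply (P k)) | None \<Rightarrow> range (blinfun_apply E))"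
    by (rule ext) (simp add: P'_def split: option.split)
  ultimately show ?thesis by simp
qed


section \<open>Basic solutions\<close>

text \<open>Collects what concerns one singular point only; the orthogonality proof interprets it
  twice, at \<open>c\<close> and \<open>c'\<close>.\<close>

locale pencil_basic_solution =
  fixes A0 A1 :: "'h :: complex_banach \<Rightarrow>\<^sub>L 'k :: complex_banach"
    and c :: complex and rho :: real and X Y :: "'k \<Rightarrow>\<^sub>L 'h"
  assumes A0 [simp]: "A0 \<in> cblinfuns" and A1 [simp]: "A1 \<in> cblinfuns"
    and basic: "basic_solution A0 A1 c rho X Y"
begin

abbreviation "Ac \<equiv> pencil A0 A1 c"
abbreviation "P \<equiv> X o\<^sub>L A1"
abbreviation "Q \<equiv> A1 o\<^sub>L X"
abbreviation "N \<equiv> X o\<^sub>L Ac"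

lemma X [simp]: "X \<in> cblinfuns" and Y [simp]: "Y \<in> cblinfuns"
  using basic by (simp_all add: basic_solution_def)

lemma YAc: "Y o\<^sub>L Ac = id_blinfun - P" and AcY: "Ac o\<^sub>L Y = id_blinfun - Q"
  using basic by (simp_all add: basic_solution_def eq_diff_eq add.commute)

lemma XAcY: "X o\<^sub>L (Ac o\<^sub>L Y) = 0"
  and YA1X: "Y o\<^sub>L (A1 o\<^sub>L X) = 0"
  using basic by (simp_all add: basic_solution_def blinfun_compose_assoc)

lemma quasinilpotent_N: "quasinilpotent N"
  using basic by (simp add: basic_solution_def quasinilpotent_def)

text \<open>With \<open>Ac Y = I - Q\<close>, the relation \<open>X Ac Y = 0\<close> reads
  \<open>X (I - Q) = 0\<close>. This is the source of the idempotence of \<open>P\<close> and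
  \<open>Q\<close>.\<close>

lemma XQ: "X o\<^sub>L (A1 o\<^sub>L X) = X"
  using XAcY by (simp add: AcY blinfun_compose_bilinear)

lemma is_projection_P: "is_projection P" and is_projection_Q: "is_projection Q"
proof -
  have "P o\<^sub>L P = (X o\<^sub>L (A1 o\<^sub>L X)) o\<^sub>L A1"
    by (simp only: blinfun_compose_assoc)
  then show "is_projection P" by (simp add: is_projection_def XQ)
  show "is_projection Q" by (simp add: is_projection_def blinfun_compose_assoc XQ)
qed

text \<open>Evaluate \<open>Ac Y Ac\<close> both as \<open>Ac (I - P)\<close> and as
  \<open>(I - Q) Ac\<close>.\<close>

lemma QAc: "Q o\<^sub>L Ac = Ac o\<^sub>L P"
proof -
  have "Ac o\<^sub>L (Y o\<^sub>L Ac) = (Ac o\<^sub>L Y) o\<^sub>L Ac"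
    by (rule blinfun_compose_assoc[symmetric])
  then show ?thesis
    by (simp add: YAc AcY blinfun_compose_bilinear)
qed

text \<open>The \<open>A1\<close> term is \<open>A1 X A1\<close> on either side, so the relation at
  \<open>c\<close> extends to every \<open>w\<close>.\<close>

lemma Q_pencil: "Q o\<^sub>L pencil A0 A1 w = pencil A0 A1 w o\<^sub>L P"
  using QAc by (simp add: pencil_shift[of _ _ w c] compose_algebra)

text \<open>Together with \<open>PN\<close>, this confines \<open>N\<close> to the range of
  \<open>P\<close>: it maps into that range and vanishes on the kernel.\<close>

lemma NP: "N o\<^sub>L P = N"
proof -
  have "N o\<^sub>L P = X o\<^sub>L (Q o\<^sub>L Ac)"
    unfolding QAc by (simp add: blinfun_compose_assoc)
  also have "\<dots> = (X o\<^sub>L (A1 o\<^sub>L X)) o\<^sub>L Ac"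
    by (simp add: blinfun_compose_assoc)
  finally show ?thesis by (simp add: XQ)
qed

lemma PN: "P o\<^sub>L N = N"
proof -
  have "P o\<^sub>L N = (X o\<^sub>L (A1 o\<^sub>L X)) o\<^sub>L Ac"
    by (simp add: blinfun_compose_assoc)
  then show ?thesis by (simp add: XQ)
qed

text \<open>Multiply \<open>Q_pencil\<close> by \<open>S\<close> from both sides.\<close>

lemma P_inverse:
  assumes "is_inverse (pencil A0 A1 w) S"
  shows "P o\<^sub>L S = S o\<^sub>L Q"
proof -
  have S: "S o\<^sub>L pencil A0 A1 w = id_blinfun" "pencil A0 A1 w o\<^sub>L S = id_blinfun"
    using assms by (simp_all add: is_inverse_def)
  have "P o\<^sub>L S = S o\<^sub>L ((pencil A0 A1 w o\<^sub>L P) o\<^sub>L S)"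
    using S by (metis blinfun_compose_assoc blinfun_compose_id(1))
  also have "\<dots> = S o\<^sub>L Q"
    unfolding Q_pencil[symmetric] blinfun_compose_assoc S by simp
  finally show ?thesis .
qed

text \<open>The identity, rather than \<open>P\<close>, is added to \<open>N\<close>, so the inverse
  lives on the whole space and exists for every \<open>w \<noteq> c\<close>; at \<open>w = c\<close>
  the value is left unspecified.\<close>

definition shift_inverse :: "complex \<Rightarrow> 'h \<Rightarrow>\<^sub>L 'h"
  where "shift_inverse w = (SOME S. is_inverse (N + (w - c) *\<^sub>C id_blinfun) S)"

lemma shift_inverse: "w \<noteq> c \<Longrightarrow> is_inverse (N + (w - c) *\<^sub>C id_blinfun) (shift_inverse w)"
  unfolding shift_inverse_def
  by (rule someI_ex) (simp add: quasinilpotent_shift_invertible quasinilpotent_N)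

text \<open>Closed form of the series with terms \<open>(-N)^j X / (w - c)^(j+1)\<close>, the
  principal part of the Laurent expansion of the resolvent about an isolated singularity
  \<open>c\<close>.\<close>

definition principal_part :: "complex \<Rightarrow> 'k \<Rightarrow>\<^sub>L 'h"
  where "principal_part w = shift_inverse w o\<^sub>L X"

text \<open>\<open>P\<close> commutes with \<open>N + (w - c)\<close>, hence with its inverse, and
  is then absorbed because \<open>P X = X = X Q\<close>.\<close>

lemma principal_part_corner:
  assumes w: "w \<noteq> c"
  shows "principal_part w \<in> corner_ops P Q"
proof -
  define G where "G = N + (w - c) *\<^sub>C id_blinfun"
  define S where "S = shift_inverse w"
  have S: "S \<in> cblinfuns" "S o\<^sub>L G = id_blinfun" "G o\<^sub>L S = id_blinfun"
    using shift_inverse[OF w] by (simp_all add: is_inverse_def G_def S_def)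
  have PG: "P o\<^sub>L G = G o\<^sub>L P"
    using PN NP by (simp add: G_def blinfun_compose_bilinear blinfun_compose_scaleC_left
        blinfun_compose_scaleC_right)
  have "P o\<^sub>L S = (S o\<^sub>L G) o\<^sub>L (P o\<^sub>L S)" by (simp add: S)
  also have "\<dots> = S o\<^sub>L ((G o\<^sub>L P) o\<^sub>L S)" by (simp only: blinfun_compose_assoc)
  also have "\<dots> = (S o\<^sub>L P) o\<^sub>L (G o\<^sub>L S)"
    unfolding PG[symmetric] by (simp only: blinfun_compose_assoc)
  finally have PS: "P o\<^sub>L S = S o\<^sub>L P" by (simp add: S)
  have "P o\<^sub>L (S o\<^sub>L X) o\<^sub>L Q = (P o\<^sub>L S) o\<^sub>L (X o\<^sub>L (A1 o\<^sub>L X))"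
    by (simp only: blinfun_compose_assoc)
  also have "\<dots> = S o\<^sub>L X"
    unfolding XQ PS by (simp add: blinfun_compose_assoc XQ)
  finally show ?thesis
    using S by (simp add: corner_ops_def principal_part_def S_def[symmetric])
qed

text \<open>\<open>N + (w - c)\<close> is itself a pencil in \<open>w\<close>, with the identity as
  leading coefficient.\<close>

lemma principal_part_cholomorphic: "principal_part cholomorphic_on - {c}"
proof -
  have "shift_inverse cholomorphic_on - {c}"
  proof (rule cholomorphic_on_pencil_inverse)
    fix w assume "w \<in> - {c}"
    then show "is_inverse (pencil (N - c *\<^sub>C id_blinfun) id_blinfun w) (shift_inverse w)"
      using shift_inverse[of w] by (simp add: pencil_def scaleC_diff_left algebra_simps)
  qed simp
  from cholomorphic_on_compose_const[OF this, of id_blinfun X] show ?thesis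
    by (simp add: principal_part_def[abs_def])
qed

text \<open>Left multiplication of \<open>A(w) S = I\<close> by \<open>X\<close> gives \<open>(N + (w - c)) P S = X\<close>.\<close>

lemma principal_part_eq:
  assumes w: "w \<noteq> c" and S: "is_inverse (pencil A0 A1 w) S"
  shows "principal_part w = P o\<^sub>L S o\<^sub>L Q"
proof -
  have "X o\<^sub>L (pencil A0 A1 w o\<^sub>L S) = X"
    using S by (simp add: is_inverse_def)
  moreover have "X o\<^sub>L pencil A0 A1 w = (N + (w - c) *\<^sub>C id_blinfun) o\<^sub>L P"
    using NP by (simp add: pencil_shift[of _ _ w c] blinfun_compose_bilinear
        blinfun_compose_scaleC_left blinfun_compose_scaleC_right)
  ultimately have "X = (N + (w - c) *\<^sub>C id_blinfun) o\<^sub>L (P o\<^sub>L S)"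
    by (metis blinfun_compose_assoc)
  then have "principal_part w = shift_inverse w o\<^sub>L ((N + (w - c) *\<^sub>C id_blinfun) o\<^sub>L (P o\<^sub>L S))"
    unfolding principal_part_def by simp
  also have "\<dots> = P o\<^sub>L S"
    using shift_inverse[OF w] unfolding blinfun_compose_assoc[symmetric]
    by (simp add: is_inverse_def)
  \<comment> \<open>A second factor \<open>P\<close> is split off and moved across \<open>S\<close>,
    where it becomes \<open>Q\<close>.\<close>
  also have "\<dots> = (P o\<^sub>L P) o\<^sub>L S"
    using is_projection_P by (simp add: is_projection_def)
  also have "\<dots> = P o\<^sub>L (P o\<^sub>L S)"
    by (rule blinfun_compose_assoc)
  also have "\<dots> = P o\<^sub>L (S o\<^sub>L Q)"
    by (simp only: P_inverse[OF S])
  also have "\<dots> = P o\<^sub>L S o\<^sub>L Q"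
    by (rule blinfun_compose_assoc[symmetric])
  finally show ?thesis .
qed

text \<open>Left multiplication of \<open>A(w) S = I\<close> by \<open>Y\<close> gives \<open>(I + (w - c) Y A1) (I - P) S = Y\<close>,
  which makes sense at \<open>w = c\<close> as well.\<close>

lemma regular_part:
  obtains e F where "e > 0" "F cholomorphic_on ball c e"
    "\<And>w. w \<in> ball c e \<Longrightarrow> F w \<in> cblinfuns"
    "\<And>w S. w \<in> ball c e \<Longrightarrow> is_inverse (pencil A0 A1 w) S \<Longrightarrow> F w = (id_blinfun - P) o\<^sub>L S"
proof -
  define B where "B = Y o\<^sub>L A1"
  have B: "B \<in> cblinfuns" by (simp add: B_def)
  \<comment> \<open>This radius forces \<open>cmod (w - c) * norm B < 1\<close>, also when
    \<open>B = 0\<close>.\<close>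
  define e where "e = inverse (norm B + 1)"
  have e: "e > 0" by (simp add: e_def add_nonneg_pos)
  define V where "V w = (SOME S. is_inverse (id_blinfun + (w - c) *\<^sub>C B) S)" for w
  have V: "is_inverse (id_blinfun + (w - c) *\<^sub>C B) (V w)" if w: "w \<in> ball c e" for w
    unfolding V_def
  proof (rule someI_ex, rule id_add_invertible[OF B])
    have "cmod (w - c) * norm B \<le> e * norm B"
      using w by (intro mult_right_mono) (auto simp: dist_norm norm_minus_commute)
    also have "\<dots> < e * (norm B + 1)"
      using e by (intro mult_strict_left_mono) auto
    also have "\<dots> = 1"
      using e by (simp add: e_def)
    finally show "cmod (w - c) * norm B < 1" .
  qed
  have "V cholomorphic_on ball c e"
  proof (rule cholomorphic_on_pencil_inverse[OF B])
    fix w assume "w \<in> ball c e"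
    from V[OF this] show "is_inverse (pencil (id_blinfun - c *\<^sub>C B) B w) (V w)"
      by (simp add: pencil_def scaleC_diff_left algebra_simps)
  qed
  from cholomorphic_on_compose_const[OF this, of id_blinfun Y]
  have "(\<lambda>w. V w o\<^sub>L Y) cholomorphic_on ball c e" by simp
  moreover have "V w o\<^sub>L Y = (id_blinfun - P) o\<^sub>L S"
    if w: "w \<in> ball c e" and S: "is_inverse (pencil A0 A1 w) S" for w S
  proof -
    \<comment> \<open>The relation \<open>Y A1 X = 0\<close> gives \<open>B P = 0\<close>, which
      lets \<open>I - P\<close> factor out of \<open>Y A(w) = I - P + (w - c) B\<close> on the
      right.\<close>
    have "B o\<^sub>L P = (Y o\<^sub>L (A1 o\<^sub>L X)) o\<^sub>L A1"
      by (simp only: B_def blinfun_compose_assoc)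
    then have "B o\<^sub>L P = 0" by (simp add: YA1X)
    then have "(id_blinfun + (w - c) *\<^sub>C B) o\<^sub>L (id_blinfun - P) = id_blinfun - P + (w - c) *\<^sub>C B"
      by (simp add: blinfun_compose_bilinear blinfun_compose_scaleC_left)
    moreover have "Y o\<^sub>L pencil A0 A1 w = id_blinfun - P + (w - c) *\<^sub>C B"
      by (simp add: pencil_shift[of _ _ w c] B_def YAc blinfun_compose_bilinear
          blinfun_compose_scaleC_right)
    ultimately have "Y o\<^sub>L pencil A0 A1 w = (id_blinfun + (w - c) *\<^sub>C B) o\<^sub>L (id_blinfun - P)"
      by simp
    moreover have "Y o\<^sub>L (pencil A0 A1 w o\<^sub>L S) = Y"
      using S by (simp add: is_inverse_def)
    ultimately have "Y = (id_blinfun + (w - c) *\<^sub>C B) o\<^sub>L ((id_blinfun - P) o\<^sub>L S)"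
      by (metis blinfun_compose_assoc)
    then have "V w o\<^sub>L Y = V w o\<^sub>L ((id_blinfun + (w - c) *\<^sub>C B) o\<^sub>L ((id_blinfun - P) o\<^sub>L S))"
      by simp
    also have "\<dots> = (id_blinfun - P) o\<^sub>L S"
      using V[OF w] unfolding blinfun_compose_assoc[symmetric] by (simp add: is_inverse_def)
    finally show ?thesis .
  qed
  moreover have "V w o\<^sub>L Y \<in> cblinfuns" if "w \<in> ball c e" for w
    using V[OF that] by (simp add: is_inverse_def)
  ultimately show ?thesis using that e by blast
qed

end

text \<open>On the ranges of \<open>P\<close> and \<open>P'\<close> the operators \<open>N - c\<close> and \<open>N' - c'\<close> both act as
  \<open>A1\<^sup>-\<^sup>1 A0\<close>, so the product \<open>P P'\<close> intertwines them, and their spectra \<open>{-c}\<close> and \<open>{-c'}\<close> are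
  disjoint.\<close>

lemma basic_solution_projections_orthogonal:
  assumes "pencil_basic_solution A0 A1 c rho X Y" "pencil_basic_solution A0 A1 c' rho' X' Y'"
    and ne: "c \<noteq> c'"
  shows "(X o\<^sub>L A1) o\<^sub>L (X' o\<^sub>L A1) = 0" and "(A1 o\<^sub>L X) o\<^sub>L (A1 o\<^sub>L X') = 0"
proof -
  interpret L: pencil_basic_solution A0 A1 c rho X Y by fact
  interpret R: pencil_basic_solution A0 A1 c' rho' X' Y' by fact
  define U where "U = L.P o\<^sub>L R.P"
  \<comment> \<open>\<open>N P = N\<close> removes the left projection from \<open>N U\<close>.
    Below, \<open>P' N' = N'\<close> and \<open>Q' Ac' = Ac' P'\<close> bring \<open>U N'\<close> to
    the same shape with \<open>Ac'\<close> in place of \<open>Ac\<close>.\<close>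
  have NU: "L.N o\<^sub>L U = X o\<^sub>L (L.Ac o\<^sub>L R.P)"
    unfolding U_def using L.NP by (metis blinfun_compose_assoc)
  have "U o\<^sub>L R.N = L.P o\<^sub>L (R.P o\<^sub>L R.N)"
    unfolding U_def by (rule blinfun_compose_assoc)
  also have "\<dots> = X o\<^sub>L (R.Q o\<^sub>L R.Ac)"
    unfolding R.PN by (simp only: blinfun_compose_assoc)
  also have "\<dots> = X o\<^sub>L (R.Ac o\<^sub>L R.P)"
    by (simp only: R.QAc)
  finally have "(L.N o\<^sub>L U) - (U o\<^sub>L R.N) = X o\<^sub>L ((L.Ac - R.Ac) o\<^sub>L R.P)"
    by (simp add: NU blinfun_compose_bilinear)
  \<comment> \<open>The pencils at \<open>c\<close> and \<open>c'\<close> differ by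
    \<open>(c - c') A1\<close>, and \<open>X A1 P' = U\<close>.\<close>
  also have "\<dots> = (c - c') *\<^sub>C U"
    by (simp add: pencil_shift[of A0 A1 c c'] U_def blinfun_compose_scaleC_left
        blinfun_compose_scaleC_right blinfun_compose_assoc)
  finally have "U = 0"
    using ne by (intro quasinilpotent_sylvester_zero[OF _ L.quasinilpotent_N R.quasinilpotent_N])
      auto
  then show "L.P o\<^sub>L R.P = 0" by (simp add: U_def)
  \<comment> \<open>\<open>P' X' = X'\<close> inserts \<open>P P'\<close> between \<open>A1\<close>
    and \<open>X'\<close>, so orthogonality of the \<open>Q\<close> follows from that of the
    \<open>P\<close>.\<close>
  have "L.Q o\<^sub>L R.Q = A1 o\<^sub>L ((L.P o\<^sub>L R.P) o\<^sub>L X')"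
    by (simp add: blinfun_compose_assoc R.XQ)
  then show "L.Q o\<^sub>L R.Q = 0"
    using \<open>L.P o\<^sub>L R.P = 0\<close> by simp
qed


section \<open>The spectral decomposition\<close>

lemma corner_opsI:
  assumes "is_projection P" "is_projection Q" "S \<in> cblinfuns"
  shows "P o\<^sub>L S o\<^sub>L Q \<in> corner_ops P Q"
proof -
  have "P o\<^sub>L (P o\<^sub>L S o\<^sub>L Q) o\<^sub>L Q = (P o\<^sub>L P) o\<^sub>L S o\<^sub>L (Q o\<^sub>L Q)"
    by (simp only: blinfun_compose_assoc)
  then show ?thesis
    using assms by (simp add: corner_ops_def is_projection_def)
qed

theorem mainTheorem5:
  fixes A0 A1 :: "'h :: complex_banach \<Rightarrow>\<^sub>L 'k :: complex_banach"
    and m :: nat and z :: "nat \<Rightarrow> complex"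
    and Rm1 R0 :: "nat \<Rightarrow> 'k \<Rightarrow>\<^sub>L 'h"
    and P :: "nat \<Rightarrow> 'h \<Rightarrow>\<^sub>L 'h" and Q :: "nat \<Rightarrow> 'k \<Rightarrow>\<^sub>L 'k"
    and Pinf :: "'h \<Rightarrow>\<^sub>L 'h" and Qinf :: "'k \<Rightarrow>\<^sub>L 'k"
    and R :: "complex \<Rightarrow> 'k \<Rightarrow>\<^sub>L 'h"
  assumes "A0 \<in> cblinfuns" and "A1 \<in> cblinfuns" and "singular A0"
    and "R = resolvent A0 A1"
    and "m \<ge> 1" and "inj_on z {1..m}"
    and "\<And>k. k \<in> {1..m} \<Longrightarrow> resolvent_isolated_singularity_at A0 A1 (z k)"
    and "\<And>w. w \<notin> z ` {1..m} \<Longrightarrow> resolvent_regular_at A0 A1 w"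
    and "\<And>k. k \<in> {1..m} \<Longrightarrow>
           basic_solution A0 A1 (z k) (recip_radius m z k) (Rm1 k) (R0 k)"
    and "\<And>k. k \<in> {1..m} \<Longrightarrow> P k = Rm1 k o\<^sub>L A1"
    and "\<And>k. k \<in> {1..m} \<Longrightarrow> Q k = A1 o\<^sub>L Rm1 k"
    and "Pinf = op_prod (\<lambda>k. id_blinfun - P k) m"
    and "Qinf = op_prod (\<lambda>k. id_blinfun - Q k) m"
  shows
    "(\<forall>k\<in>{1..m}. \<forall>l\<in>{1..m}. k \<noteq> l \<longrightarrow> P k o\<^sub>L P l = 0 \<and> Q k o\<^sub>L Q l = 0) \<and>
     Pinf = id_blinfun - (\<Sum>k=1..m. P k) \<and> Qinf = id_blinfun - (\<Sum>k=1..m. Q k) \<and>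
     is_projection Pinf \<and> is_projection Qinf \<and>

     direct_sum (insert None (Some ` {1..m}))
       (\<lambda>i. case i of Some k \<Rightarrow> range (blinfun_apply (P k)) | None \<Rightarrow> range (blinfun_apply Pinf)) \<and>
     direct_sum (insert None (Some ` {1..m}))
       (\<lambda>i. case i of Some k \<Rightarrow> range (blinfun_apply (Q k)) | None \<Rightarrow> range (blinfun_apply Qinf)) \<and>

     (\<forall>w. w \<notin> z ` {1..m} \<longrightarrow>
        R w = (\<Sum>k=1..m. P k o\<^sub>L R w o\<^sub>L Q k) + (Pinf o\<^sub>L R w o\<^sub>L Qinf)) \<and>
     (\<forall>k\<in>{1..m}. \<exists>F. (\<forall>w. w \<noteq> z k \<longrightarrow> F w \<in> corner_ops (P k) (Q k)) \<and>
        F canalytic_on (- {z k}) \<and>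
        (\<forall>w. w \<notin> z ` {1..m} \<longrightarrow> F w = P k o\<^sub>L R w o\<^sub>L Q k)) \<and>
     (\<exists>F. (\<forall>w. F w \<in> corner_ops Pinf Qinf) \<and>
        F canalytic_on UNIV \<and>
        (\<forall>w. w \<notin> z ` {1..m} \<longrightarrow> F w = Pinf o\<^sub>L R w o\<^sub>L Qinf))"
proof -
  let ?I = "{1..m}"
  let ?Z = "z ` ?I"

  \<comment> \<open>Basic solutions and the resolvent off the singular points\<close>
  have bs: "pencil_basic_solution A0 A1 (z k) (recip_radius m z k) (Rm1 k) (R0 k)"
    if "k \<in> ?I" for k
    using assms(1,2,9) that by unfold_locales auto
  have R: "is_inverse (pencil A0 A1 w) (R w)" if "w \<notin> ?Z" for w
  proof -
    have "\<not> singular (pencil A0 A1 w)"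
      using assms(8)[OF that] unfolding resolvent_regular_at_def by force
    then show ?thesis unfolding assms(4) by (rule is_inverse_resolvent)
  qed

  \<comment> \<open>Orthogonality and the complementary projections\<close>
  have projP: "is_projection (P k)" and projQ: "is_projection (Q k)" if "k \<in> ?I" for k
    using pencil_basic_solution.is_projection_P[OF bs[OF that]]
      pencil_basic_solution.is_projection_Q[OF bs[OF that]]
    by (simp_all add: assms(10,11)[OF that])
  have orthP: "P k o\<^sub>L P l = 0" and orthQ: "Q k o\<^sub>L Q l = 0"
    if "k \<in> ?I" "l \<in> ?I" "k \<noteq> l" for k l
  proof -
    have "z k \<noteq> z l" using assms(6) that by (auto dest: inj_onD)
    from basic_solution_projections_orthogonal[OF bs[OF that(1)] bs[OF that(2)] this]
    show "P k o\<^sub>L P l = 0" "Q k o\<^sub>L Q l = 0"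
      by (simp_all add: assms(10,11)[OF that(1)] assms(10,11)[OF that(2)])
  qed
  have Pinf: "Pinf = id_blinfun - (\<Sum>k=1..m. P k)"
    unfolding assms(12) by (rule op_prod_id_minus_orthogonal) (rule orthP)
  have Qinf: "Qinf = id_blinfun - (\<Sum>k=1..m. Q k)"
    unfolding assms(13) by (rule op_prod_id_minus_orthogonal) (rule orthQ)
  note Pinf_props = orthogonal_id_minus_sum[where P = P and I = ?I, OF _ projP orthP, folded Pinf, simplified]
  note Qinf_props = orthogonal_id_minus_sum[where P = Q and I = ?I, OF _ projQ orthQ, folded Qinf, simplified]

  \<comment> \<open>Intertwining by the resolvent and its decomposition\<close>
  have PR: "P k o\<^sub>L R w = R w o\<^sub>L Q k" if "k \<in> ?I" "w \<notin> ?Z" for k w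
    using pencil_basic_solution.P_inverse[OF bs[OF that(1)] R[OF that(2)]]
    by (simp add: assms(10,11)[OF that(1)])
  have PinfR: "Pinf o\<^sub>L R w = R w o\<^sub>L Qinf" if "w \<notin> ?Z" for w
    by (simp add: Pinf Qinf blinfun_compose_bilinear blinfun_compose_sum_left
        blinfun_compose_sum_right PR[OF _ that])

  have decomposition: "R w = (\<Sum>k=1..m. P k o\<^sub>L R w o\<^sub>L Q k) + (Pinf o\<^sub>L R w o\<^sub>L Qinf)"
    if w: "w \<notin> ?Z" for w
  proof -
    \<comment> \<open>Intertwining turns the summands into \<open>R w Q k\<close> and
      \<open>R w Qinf\<close>, whose right factors sum to the identity.\<close>
    have "P k o\<^sub>L R w o\<^sub>L Q k = R w o\<^sub>L Q k" if "k \<in> ?I" for k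
      using projQ[OF that] by (simp add: PR[OF that w] is_projection_def blinfun_compose_assoc)
    moreover have "Pinf o\<^sub>L R w o\<^sub>L Qinf = R w o\<^sub>L Qinf"
      using Qinf_props(3) by (simp add: PinfR[OF w] is_projection_def blinfun_compose_assoc)
    ultimately show ?thesis
      by (simp add: Qinf blinfun_compose_bilinear blinfun_compose_sum_right)
  qed

  \<comment> \<open>Analytic extension of the part at a finite point\<close>
  have finite_part: "\<exists>F. (\<forall>w. w \<noteq> z k \<longrightarrow> F w \<in> corner_ops (P k) (Q k)) \<and>
      F canalytic_on (- {z k}) \<and> (\<forall>w. w \<notin> ?Z \<longrightarrow> F w = P k o\<^sub>L R w o\<^sub>L Q k)"
    if k: "k \<in> ?I" for k
  proof -
    interpret pencil_basic_solution A0 A1 "z k" "recip_radius m z k" "Rm1 k" "R0 k"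
      by (rule bs[OF k])
    \<comment> \<open>The witness \<open>principal_part\<close> matches \<open>P k R Q k\<close> off
      all singular points and stays holomorphic at the other \<open>z l\<close>.\<close>
    have "w \<noteq> z k" if "w \<notin> ?Z" for w using that k by auto
    then show ?thesis
      using principal_part_corner principal_part_eq[OF _ R]
        canalytic_onI_open[OF _ principal_part_cholomorphic]
      unfolding assms(10,11)[OF k] by (intro exI[of _ principal_part]) auto
  qed

  \<comment> \<open>Entire extension of the part at infinity\<close>
  have "\<forall>k\<in>?I. \<exists>e G. e > 0 \<and> G cholomorphic_on ball (z k) e \<and>
      (\<forall>w\<in>ball (z k) e. G w \<in> cblinfuns \<and> (w \<notin> ?Z \<longrightarrow> G w = (id_blinfun - P k) o\<^sub>L R w))"
  proof
    fix k assume k: "k \<in> ?I"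
    show "\<exists>e G. e > 0 \<and> G cholomorphic_on ball (z k) e \<and>
      (\<forall>w\<in>ball (z k) e. G w \<in> cblinfuns \<and> (w \<notin> ?Z \<longrightarrow> G w = (id_blinfun - P k) o\<^sub>L R w))"
      using pencil_basic_solution.regular_part[OF bs[OF k]] R unfolding assms(10)[OF k] by metis
  qed
  then obtain e G where e: "\<And>k. k \<in> ?I \<Longrightarrow> e k > (0 :: real)"
    and G: "\<And>k. k \<in> ?I \<Longrightarrow> G k cholomorphic_on ball (z k) (e k)"
    and Gcl: "\<And>k w. k \<in> ?I \<Longrightarrow> w \<in> ball (z k) (e k) \<Longrightarrow> G k w \<in> cblinfuns"
    and GR: "\<And>k w. k \<in> ?I \<Longrightarrow> w \<in> ball (z k) (e k) \<Longrightarrow> w \<notin> ?Z \<Longrightarrow>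
      G k w = (id_blinfun - P k) o\<^sub>L R w"
    by metis
  \<comment> \<open>At a singular point the value comes from the local function \<open>G k\<close>;
    injectivity of \<open>z\<close> lets \<open>inv_into\<close> recover \<open>k\<close>.\<close>
  define F where "F w = Pinf o\<^sub>L (if w \<in> ?Z then G (inv_into ?I z w) w else R w) o\<^sub>L Qinf" for w
  have Fz: "F (z k) = Pinf o\<^sub>L G k (z k) o\<^sub>L Qinf" if "k \<in> ?I" for k
    using that assms(6) by (simp add: F_def inv_into_f_f)
  have Pinf_cl: "Pinf \<in> cblinfuns"
    using Pinf_props(3) by (simp add: is_projection_def)
  have "F canalytic_on UNIV"
    unfolding canalytic_on_def
  proof
    fix w0 :: complex
    have "finite ?Z" by simp
    \<comment> \<open>\<open>d\<close> keeps all other singular points out of the ball around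
      \<open>w0\<close>.\<close>
    from finite_set_avoid[OF this, of w0] obtain d where d: "d > 0" "\<And>w. w \<in> ?Z \<Longrightarrow> w \<noteq> w0 \<Longrightarrow> d \<le> dist w0 w"
      by auto
    then have avoid: "w \<notin> ?Z" if "w \<in> ball w0 d" "w \<noteq> w0" for w
      using that by fastforce
    show "\<exists>r>0. F cholomorphic_on ball w0 r"
    proof (cases "w0 \<in> ?Z")
      case True
      then obtain k where k: "k \<in> ?I" "w0 = z k" by auto
      have "Pinf o\<^sub>L G k w o\<^sub>L Qinf = F w" if w: "w \<in> ball w0 (min d (e k))" for w
      proof (cases "w = w0")
        case True
        then show ?thesis using Fz k by simp
      next
        case False
        then have "w \<notin> ?Z" using w by (intro avoid) auto
        moreover have "w \<in> ball (z k) (e k)" using w k by auto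
        \<comment> \<open>\<open>Pinf P k = 0\<close> lets \<open>Pinf\<close> absorb
          \<open>I - P k\<close>, so \<open>Pinf G k Qinf\<close> agrees with \<open>F\<close> near
          \<open>z k\<close>, centre included: the singularity is removable.\<close>
        moreover have "Pinf o\<^sub>L ((id_blinfun - P k) o\<^sub>L R w) = Pinf o\<^sub>L R w"
          using Pinf_props(2)[of k] k unfolding blinfun_compose_assoc[symmetric]
          by (simp add: blinfun_compose_bilinear)
        ultimately show ?thesis using k by (simp add: F_def GR)
      qed
      moreover have "(\<lambda>w. Pinf o\<^sub>L G k w o\<^sub>L Qinf) cholomorphic_on ball w0 (min d (e k))"
        using k by (intro cholomorphic_on_compose_const cholomorphic_on_subset[OF G[OF k(1)]] Pinf_cl)
          auto
      ultimately have "F cholomorphic_on ball w0 (min d (e k))"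
        by (rule cholomorphic_on_cong)
      then show ?thesis using d e k by (intro exI[of _ "min d (e k)"]) auto
    next
      case False
      then obtain r where r: "r > 0" "R cholomorphic_on ball w0 r"
        using assms(8)[OF False] unfolding resolvent_regular_at_def assms(4) by auto
      have "Pinf o\<^sub>L R w o\<^sub>L Qinf = F w" if "w \<in> ball w0 (min d r)" for w
      proof -
        have "w \<notin> ?Z" using that False avoid[of w] by (cases "w = w0") auto
        then show ?thesis by (simp add: F_def)
      qed
      moreover have "(\<lambda>w. Pinf o\<^sub>L R w o\<^sub>L Qinf) cholomorphic_on ball w0 (min d r)"
        by (intro cholomorphic_on_compose_const cholomorphic_on_subset[OF r(2)] Pinf_cl) auto
      ultimately have "F cholomorphic_on ball w0 (min d r)"
        by (rule cholomorphic_on_cong)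
      then show ?thesis using d r by (intro exI[of _ "min d r"]) auto
    qed
  qed
  moreover have "F w \<in> corner_ops Pinf Qinf" for w
  proof (cases "w \<in> ?Z")
    case True
    then obtain k where k: "k \<in> ?I" "w = z k" by auto
    then show ?thesis
      unfolding k(2) Fz[OF k(1)] using Pinf_props(3) Qinf_props(3) e Gcl
      by (intro corner_opsI) auto
  next
    case False
    then show ?thesis
      unfolding F_def using Pinf_props(3) Qinf_props(3) R[OF False]
      by (intro corner_opsI) (auto simp: is_inverse_def)
  qed
  moreover have "F w = Pinf o\<^sub>L R w o\<^sub>L Qinf" if "w \<notin> ?Z" for w
    using that by (simp add: F_def)
  ultimately have infinite_part: "\<exists>F. (\<forall>w. F w \<in> corner_ops Pinf Qinf) \<and> F canalytic_on UNIV \<and>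
      (\<forall>w. w \<notin> ?Z \<longrightarrow> F w = Pinf o\<^sub>L R w o\<^sub>L Qinf)"
    by blast

  \<comment> \<open>Direct sum decompositions and conclusion\<close>
  have sumP: "direct_sum (insert None (Some ` ?I))
      (\<lambda>i. case i of Some k \<Rightarrow> range (blinfun_apply (P k)) | None \<Rightarrow> range (blinfun_apply Pinf))"
    by (rule direct_sum_projections_complement[OF _ projP orthP Pinf]) simp
  have sumQ: "direct_sum (insert None (Some ` ?I))
      (\<lambda>i. case i of Some k \<Rightarrow> range (blinfun_apply (Q k)) | None \<Rightarrow> range (blinfun_apply Qinf))"
    by (rule direct_sum_projections_complement[OF _ projQ orthQ Qinf]) simp
  show ?thesis
    using orthP orthQ Pinf Qinf Pinf_props(3) Qinf_props(3) sumP sumQ decomposition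
      finite_part infinite_part
    by (intro conjI ballI allI impI)
qed

end
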